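(* Let $\mathcal X$ be a finite or countably infinite alphabet, $n$ a positive integer and $p$ a distribution over $\mathcal X$. Let $\mathcal D_n$ be the profile dimension of an i.i.d. sample $X^n\sim p$, and let \[ E_n(p):=\mathbb E\left[\sum_{u=1}^{n}\ \bigvee_{x\in\mathcal X}\mathbf 1_{\mu_x(X^N)=u}\right], \] where $N\sim\mathrm{Poi}(n)$ is independent of the i.i.d. samples from $p$. Then for any $\gamma>0$, \[ \Pr\left(\frac{\mathcal D_n}{1+\gamma}\ge E_n(p)\right)\le 3\sqrt n\,e^{-\min\{\gamma^2,\gamma\}E_n(p)/3}, \] and for any $\gamma\in(0,1)$, \[ \Pr\left(\frac{\mathcal D_n}{1-\gamma}\le E_n(p)\right)\le 3\sqrt n\,e^{-\gamma^2E_n(p)/2}. \]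
   Context: For a sequence $x^m$ over $\mathcal X$ and $y\in\mathcal X$, $\mu_y(x^m)$ is the number of times $y$ appears in $x^m$. The profile dimension of $x^n$ is the number of distinct values among the multiplicities of the symbols appearing in $x^n$, so $\mathcal D_n=\sum_{\mu=1}^n\bigvee_{x\in\mathcal X}\mathbf 1_{\mu_x(X^n)=\mu}$. $\bigvee$ is logical OR. $X^N$ denotes an i.i.d. sample from $p$ of random size $N\sim\mathrm{Poi}(n)$ (Poisson with mean $n$), where $N$ is independent of the sample values; note the sum defining $E_n(p)$ runs only up to $n$. *)

theory Defs
  imports "HOL-Probability.Probability"
begin

definition profile_dim :: "'a list \<Rightarrow> nat" where
  "profile_dim xs = card (count_list xs ` set xs)"

lemma profile_dim_altdef:
  assumes "set xs \<subseteq> X" and "length xs = n"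
  shows "profile_dim xs = (\<Sum>u=1..n. of_bool (\<exists>x\<in>X. count_list xs x = u))"
proof -
  have "count_list xs ` set xs = {u\<in>{1..n}. \<exists>x\<in>X. count_list xs x = u}"
  proof (intro equalityI subsetI)
    fix u assume "u \<in> count_list xs ` set xs"
    then obtain x where x: "x \<in> set xs" "u = count_list xs x" by auto
    then have "u \<noteq> 0" by (simp add: count_list_0_iff)
    moreover have "u \<le> n" using x assms(2) count_le_length[of xs x] by simp
    ultimately show "u \<in> {u\<in>{1..n}. \<exists>x\<in>X. count_list xs x = u}"
      using x assms(1) by auto
  next
    fix u assume "u \<in> {u\<in>{1..n}. \<exists>x\<in>X. count_list xs x = u}"
    then obtain x where x: "u \<ge> 1" "count_list xs x = u" by auto
    then have "x \<in> set xs" using count_list_0_iff[of xs x] by auto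
    then show "u \<in> count_list xs ` set xs" using x by auto
  qed
  then show ?thesis
    by (simp add: profile_dim_def of_bool_def sum.If_cases Int_def)
qed

text \<open>Law of an i.i.d. sample from \<open>p\<close> whose size is Poisson with mean \<open>n\<close> and independent of
  the sample values.\<close>
definition poissonized_sample :: "nat \<Rightarrow> 'a pmf \<Rightarrow> 'a list pmf" where
  "poissonized_sample n p = bind_pmf (poisson_pmf (real n)) (\<lambda>N. replicate_pmf N p)"

text \<open>The sum stops at \<open>n\<close> although the sample may be longer, so this is not in general the
  expectation of \<^const>\<open>profile_dim\<close>.\<close>
definition expected_profile_dim :: "'a set \<Rightarrow> nat \<Rightarrow> 'a pmf \<Rightarrow> real" where
  "expected_profile_dim X n p =
     measure_pmf.expectation (poissonized_sample n p)
       (\<lambda>xs. \<Sum>u=1..n. of_bool (\<exists>x\<in>X. count_list xs x = u))"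

end

theory Submission imports Defs begin

text \<open>
  Under Poisson sampling the multiplicities of the symbols are independent, and for such a family
  the events \<open>B u\<close> that some symbol has multiplicity \<open>u\<close> are negatively dependent: the probability
  that all of \<open>B u\<close>, \<open>u \<in> S\<close>, occur is at most the product of their probabilities, and likewise for
  the complements. Hence the number \<open>D\<close> of \<open>u \<le> n\<close> for which \<open>B u\<close> occurs has moment generating
  function \<open>E[a ^ D] \<le> exp ((a - 1) * E[D])\<close>, as for independent indicators, and the Chernoff bound
  with \<open>a = 1 + \<gamma>\<close> and \<open>a = 1 - \<gamma>\<close> gives both tails. A fixed-size sample is a Poisson
  sample conditioned on \<open>N = n\<close>, an event of probability at least \<open>1 / (3 * sqrt n)\<close> by Stirling, and
  on it \<open>D\<close> is the profile dimension.
\<close>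

section \<open>Probabilities and expectations under discrete laws\<close>

lemma measure_bind_pmf:
  "measure_pmf.prob (bind_pmf M f) A = measure_pmf.expectation M (\<lambda>x. measure_pmf.prob (f x) A)"
proof -
  \<comment> \<open>The probability of an event is the mass at \<open>True\<close> of its truth
    value, which reduces the claim to point masses.\<close>
  have *: "measure_pmf.prob N A = pmf (map_pmf (\<lambda>x. x \<in> A) N) True" for N
    by (simp add: pmf_map vimage_def)
  show ?thesis
    unfolding * map_bind_pmf pmf_bind ..
qed

lemma integrable_prob_pmf: "integrable (measure_pmf M) (\<lambda>x. measure_pmf.prob (f x) (A x))"
  by (rule measure_pmf.integrable_const_bound[where B = 1]) auto

lemma expectation_nat_pmf_bounded:
  fixes f :: "nat \<Rightarrow> real"
  assumes "\<And>k. \<bar>f k\<bar> \<le> B"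
  shows "measure_pmf.expectation q f = (\<Sum>k. pmf q k * f k)"
proof -
  have int: "integrable (measure_pmf q) f"
    by (rule measure_pmf.integrable_const_bound[where B = B]) (auto simp: assms)
  have "measure_pmf.expectation q f = integral\<^sup>L (count_space UNIV) (\<lambda>k. pmf q k *\<^sub>R f k)"
    by (simp add: measure_pmf_eq_density integral_density)
  moreover have "integrable (count_space UNIV) (\<lambda>k. pmf q k *\<^sub>R f k)"
    using int by (simp add: measure_pmf_eq_density integrable_density)
  ultimately show ?thesis
    by (simp add: integral_count_space_nat)
qed

section \<open>Chernoff exponents\<close>

text \<open>The midpoint bound for the integral of \<open>1 / t\<close> over
  \<open>[1, 1 + g]\<close> leaves \<open>g\<^sup>2 / (2 + g)\<close>, and \<open>2 + g\<close> is
  at most \<open>3\<close> for \<open>g \<le> 1\<close> and at most \<open>3 * g\<close>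
  otherwise.\<close>

lemma chernoff_exponent_upper:
  fixes g :: real
  assumes "g > 0"
  shows "min (g\<^sup>2) g / 3 \<le> (1 + g) * ln (1 + g) - g"
proof -
  have "2 * g / (2 + g) \<le> ln (1 + g)"
    using ln_inverse_approx_ge[of 1 "1 + g"] assms by (simp add: add.assoc)
  then have "(1 + g) * (2 * g / (2 + g)) \<le> (1 + g) * ln (1 + g)"
    using assms by (intro mult_left_mono) auto
  moreover have "(1 + g) * (2 * g / (2 + g)) - g = g\<^sup>2 / (2 + g)"
    using assms by (simp add: field_simps power2_eq_square)
  moreover have "min (g\<^sup>2) g / 3 \<le> g\<^sup>2 / (2 + g)"
  proof (cases "g \<le> 1")
    case True
    then have "g\<^sup>2 / 3 \<le> g\<^sup>2 / (2 + g)"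
      using assms by (intro divide_left_mono) auto
    then show ?thesis by (smt (verit) divide_right_mono)
  next
    case False
    then have "g * 1 \<le> g * g"
      by (intro mult_left_mono) auto
    then have "g / 3 \<le> g\<^sup>2 / (2 + g)"
      using assms by (simp add: field_simps power2_eq_square)
    then show ?thesis by (smt (verit) divide_right_mono)
  qed
  ultimately show ?thesis by linarith
qed

text \<open>The trapezoidal rule overestimates the integral of the convex function
  \<open>1 / t\<close> over \<open>[1 - g, 1]\<close>, which is \<open>- ln (1 - g)\<close>.\<close>

lemma chernoff_exponent_lower:
  fixes g :: real
  assumes "0 < g" "g < 1"
  shows "g\<^sup>2 / 2 \<le> (1 - g) * ln (1 - g) + g"
proof -
  have "- ln (1 - g) \<le> g * (inverse (1 - g) + 1) / 2"
    using ln_inverse_approx_le[of "1 - g" g] assms by simp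
  then have "(1 - g) * (- ln (1 - g)) \<le> (1 - g) * (g * (inverse (1 - g) + 1) / 2)"
    using assms by (intro mult_left_mono) auto
  also have "\<dots> = g - g\<^sup>2 / 2"
    using assms by (simp add: field_simps power2_eq_square)
  finally show ?thesis by simp
qed

section \<open>Stirling's bound and the Poisson mass at the mean\<close>

text \<open>The constant \<open>exp 1\<close> gives equality at \<open>n = 1\<close>. The induction
  step asks that the right-hand side grow by a factor of at least \<open>n + 1\<close>, that is
  \<open>(n + 1/2) * (ln (n + 1) - ln n) \<ge> 1\<close>, again a midpoint bound.\<close>

lemma fact_le_exp_sqrt:
  assumes "n > 0"
  shows "fact n \<le> exp 1 * sqrt (real n) * (real n ^ n * exp (- real n))"
  using assms
proof (induction n rule: nat_induct_non_zero)
  case (Suc n)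
  define x where "x = real n"
  have x: "x > 0" using Suc by (simp add: x_def)
  have "2 / (2 * x + 1) \<le> ln (x + 1) - ln x"
    using ln_inverse_approx_ge[of x "x + 1"] x by simp
  then have "1 \<le> (x + 1/2) * (ln (x + 1) - ln x)"
    using x by (simp add: field_simps)
  then have "ln (x + 1) + ((x + 1 / 2) * ln x - x) \<le> (x + 3 / 2) * ln (x + 1) - (x + 1)"
    by (simp add: algebra_simps)
  then have "exp (ln (x + 1) + ((x + 1/2) * ln x - x)) \<le> exp ((x + 3/2) * ln (x + 1) - (x + 1))"
    by simp
  moreover have key: "exp ((real k + 1/2) * ln (real k) - real k) = sqrt k * (real k ^ k * exp (- real k))"
    if "k > 0" for k
  proof -
    have "exp (1/2 * ln (real k)) = sqrt k"
      using that powr_half_sqrt[of "real k"] by (simp add: powr_def)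
    moreover have "exp (real k * ln (real k)) = real k ^ k"
      using that by (simp add: exp_of_nat_mult)
    moreover have "exp ((real k + 1/2) * ln (real k) - real k)
        = exp (1/2 * ln (real k)) * (exp (real k * ln (real k)) * exp (- real k))"
      unfolding exp_add[symmetric] by (rule arg_cong[where f = exp]) (simp add: algebra_simps)
    ultimately show ?thesis by simp
  qed
  moreover have "exp (ln (x + 1) + ((x + 1/2) * ln x - x)) = (x + 1) * exp ((x + 1/2) * ln x - x)"
    using x by (simp add: exp_add)
  moreover have "(x + 3/2) * ln (x + 1) - (x + 1) = (real (Suc n) + 1/2) * ln (real (Suc n)) - real (Suc n)"
    by (simp add: x_def algebra_simps)
  ultimately have "(x + 1) * (sqrt n * (real n ^ n * exp (- real n)))
      \<le> sqrt (Suc n) * (real (Suc n) ^ Suc n * exp (- real (Suc n)))"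
    using Suc.hyps by (simp only: x_def key zero_less_Suc)
  then have "exp 1 * ((x + 1) * (sqrt n * (real n ^ n * exp (- real n))))
      \<le> exp 1 * (sqrt (Suc n) * (real (Suc n) ^ Suc n * exp (- real (Suc n))))"
    by (intro mult_left_mono) auto
  moreover have "fact (Suc n) \<le> (x + 1) * (exp 1 * sqrt n * (real n ^ n * exp (- real n)))"
    using Suc.IH x by (simp add: x_def add.commute mult_left_mono)
  ultimately show ?case by (simp add: algebra_simps)
qed (simp flip: exp_add)

text \<open>Source of the factor \<open>3 * sqrt n\<close> in both tails; the \<open>3\<close>
  rounds up \<open>exp 1\<close>.\<close>

lemma pmf_poisson_mean_ge:
  assumes "n > 0"
  shows "1 / (3 * sqrt (real n)) \<le> pmf (poisson_pmf (real n)) n"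
proof -
  have "fact n \<le> exp 1 * sqrt (real n) * (real n ^ n * exp (- real n))"
    by (rule fact_le_exp_sqrt[OF assms])
  also have "\<dots> \<le> 3 * sqrt (real n) * (real n ^ n * exp (- real n))"
    using exp_le by (intro mult_right_mono) auto
  finally show ?thesis
    using assms by (simp add: field_simps)
qed

section \<open>From negative dependence to expectations of products\<close>

text \<open>Expand the product over the subsets of \<open>U\<close>. All coefficients are
  nonnegative, so \<open>neg\<close> applies to each term, and the resulting sum is again the
  expansion of a product.\<close>

lemma expectation_prod_of_bool_le:
  fixes M :: "'a pmf" and B :: "'u \<Rightarrow> 'a \<Rightarrow> bool" and c d :: real
  assumes U: "finite U" and nn: "c \<ge> 0" "d \<ge> 0"
    and neg: "\<And>S. S \<subseteq> U \<Longrightarrow> measure_pmf.prob M {\<omega>. \<forall>u\<in>S. B u \<omega>} \<le> (\<Prod>u\<in>S. measure_pmf.prob M {\<omega>. B u \<omega>})"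
  shows "measure_pmf.expectation M (\<lambda>\<omega>. \<Prod>u\<in>U. c * of_bool (B u \<omega>) + d)
           \<le> (\<Prod>u\<in>U. c * measure_pmf.prob M {\<omega>. B u \<omega>} + d)"
proof -
  have fin: "finite S" if "S \<subseteq> U" for S using U that finite_subset by auto
  have eq: "(\<Prod>u\<in>U. c * of_bool (B u \<omega>) + d)
      = (\<Sum>S\<in>Pow U. c ^ card S * d ^ card (U - S) * indicator {\<omega>. \<forall>u\<in>S. B u \<omega>} \<omega>)" for \<omega>
    unfolding prod_add[OF U]
    by (intro sum.cong refl) (auto simp: prod.distrib of_bool_def fin indicator_def intro!: prod_zero)
  have "measure_pmf.expectation M (\<lambda>\<omega>. \<Prod>u\<in>U. c * of_bool (B u \<omega>) + d)
      = (\<Sum>S\<in>Pow U. c ^ card S * d ^ card (U - S) * measure_pmf.prob M {\<omega>. \<forall>u\<in>S. B u \<omega>})"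
    unfolding eq by (subst Bochner_Integration.integral_sum)
      (auto intro!: measure_pmf.integrable_const_bound[where B = 1] split: split_indicator)
  also have "\<dots> \<le> (\<Sum>S\<in>Pow U. c ^ card S * d ^ card (U - S) * (\<Prod>u\<in>S. measure_pmf.prob M {\<omega>. B u \<omega>}))"
    by (intro sum_mono mult_left_mono neg) (auto simp: nn)
  also have "\<dots> = (\<Prod>u\<in>U. c * measure_pmf.prob M {\<omega>. B u \<omega>} + d)"
    unfolding prod_add[OF U] by (intro sum.cong refl) (auto simp: prod.distrib fin)
  finally show ?thesis .
qed

section \<open>Negative dependence of occupied values\<close>

lemma prob_Pi_pmf_insert:
  assumes "finite F" "i \<notin> F"
  shows "measure_pmf.prob (Pi_pmf (insert i F) d q) A =
    measure_pmf.expectation (q i) (\<lambda>z. measure_pmf.prob (Pi_pmf F d q) {f. f(i := z) \<in> A})"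
  by (simp add: Pi_pmf_insert'[OF assms] measure_bind_pmf vimage_def flip: map_pmf_def)

text \<open>Avoidance, unlike occupation, constrains each coordinate separately.\<close>

lemma prob_Pi_pmf_avoid:
  assumes "finite F"
  shows "measure_pmf.prob (Pi_pmf F d q) {f. \<forall>v\<in>S. \<not> (\<exists>j\<in>F. f j = v)}
           = (\<Prod>j\<in>F. measure_pmf.prob (q j) (- S))"
proof -
  have "{f. \<forall>v\<in>S. \<not> (\<exists>j\<in>F. f j = v)} = Pi F (\<lambda>_. - S)" by auto
  then show ?thesis by (simp add: measure_Pi_pmf_Pi assms)
qed

text \<open>In each coordinate this is \<open>1 - x - y \<le> (1 - x) * (1 - y)\<close> for the
  masses \<open>x\<close> of \<open>u\<close> and \<open>y\<close> of \<open>S\<close>, which add up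
  because \<open>u\<close> is outside \<open>S\<close>.\<close>

lemma prob_avoid_insert_le:
  assumes "finite F" "u \<notin> S"
  shows "measure_pmf.prob (Pi_pmf F d q) {f. \<forall>v\<in>insert u S. \<not> (\<exists>j\<in>F. f j = v)}
    \<le> measure_pmf.prob (Pi_pmf F d q) {f. \<not> (\<exists>j\<in>F. f j = u)}
      * measure_pmf.prob (Pi_pmf F d q) {f. \<forall>v\<in>S. \<not> (\<exists>j\<in>F. f j = v)}"
proof -
  have le: "measure_pmf.prob r (- insert u S) \<le> measure_pmf.prob r (- {u}) * measure_pmf.prob r (- S)" for r
  proof -
    have "measure_pmf.prob r (insert u S) = measure_pmf.prob r {u} + measure_pmf.prob r S"
      using assms measure_pmf.finite_measure_Union[of "{u}" r S] by simp
    moreover have compl: "measure_pmf.prob r (- T) = 1 - measure_pmf.prob r T" for T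
      using measure_pmf.prob_compl[of T r] by (simp add: Compl_eq_Diff_UNIV)
    ultimately show ?thesis
      unfolding compl by (simp add: algebra_simps)
  qed
  have single: "measure_pmf.prob (Pi_pmf F d q) {f. \<not> (\<exists>j\<in>F. f j = u)}
      = (\<Prod>j\<in>F. measure_pmf.prob (q j) (- {u}))"
    using prob_Pi_pmf_avoid[OF assms(1), of d q "{u}"] by simp
  show ?thesis
    unfolding prob_Pi_pmf_avoid[OF assms(1)] single prod.distrib[symmetric]
    by (intro prod_mono conjI le) auto
qed

text \<open>
  Conditioning on \<open>u\<close> being avoided redistributes the mass of \<open>u\<close> among the other values, which
  can only help to occupy \<open>S\<close>.
\<close>

lemma prob_occupied_avoid_ge:
  assumes "finite F" "u \<notin> S"
  shows "measure_pmf.prob (Pi_pmf F d q) {f. \<forall>v\<in>S. \<exists>j\<in>F. f j = v}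
      * measure_pmf.prob (Pi_pmf F d q) {f. \<not> (\<exists>j\<in>F. f j = u)}
    \<le> measure_pmf.prob (Pi_pmf F d q) {f. (\<forall>v\<in>S. \<exists>j\<in>F. f j = v) \<and> \<not> (\<exists>j\<in>F. f j = u)}"
  using assms
proof (induction F arbitrary: S rule: finite_induct)
  case (insert i F)
  let ?P = "measure_pmf.prob (Pi_pmf F d q)"
  define a where "a = ?P {f. \<not> (\<exists>j\<in>F. f j = u)}"
  \<comment> \<open>Once coordinate \<open>i\<close> takes the value \<open>z\<close>, the others
    must still occupy \<open>S - {z}\<close>. As \<open>u\<close> is outside \<open>S\<close>, the
    value \<open>u\<close> contributes nothing, so \<open>h u\<close> is the least value of
    \<open>h\<close>. \<open>T\<close> collects the cases \<open>z \<noteq> u\<close>.\<close>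
  define h where "h = (\<lambda>z. ?P {f. \<forall>v\<in>S - {z}. \<exists>j\<in>F. f j = v})"
  define T where "T = measure_pmf.expectation (q i) (\<lambda>z. indicator (- {u}) z * h z)"
  define r where "r = pmf (q i) u"
  have r: "0 \<le> r" "r \<le> 1" by (auto simp: r_def pmf_le_1)
  have h01: "0 \<le> h z" "h z \<le> 1" for z by (auto simp: h_def)
  have int: "integrable (measure_pmf (q i)) (\<lambda>z. indicator (- {u}) z * h z)"
      "integrable (measure_pmf (q i)) (\<lambda>z. indicator {u} z * h u)"
      "integrable (measure_pmf (q i)) (\<lambda>z. indicator (- {u}) z * h u)"
      "integrable (measure_pmf (q i)) (\<lambda>z. indicator (- {u}) z * (h z * a))"
    using h01 by (auto intro!: measure_pmf.integrable_const_bound[where B = 1] AE_pmfI mult_le_one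
      simp: a_def abs_mult split: split_indicator)
  have compl: "measure_pmf.prob (q i) (- {u}) = 1 - r"
    using measure_pmf.prob_compl[of "{u}" "q i"] by (simp add: Compl_eq_Diff_UNIV r_def measure_pmf_single)
  have avoid: "measure_pmf.prob (Pi_pmf (insert i F) d q) {f. \<not> (\<exists>j\<in>insert i F. f j = u)} = (1 - r) * a"
  proof -
    have "?P {f. f(i := z) \<in> {f. \<not> (\<exists>j\<in>insert i F. f j = u)}} = indicator (- {u}) z * a" for z
    proof -
      have "{f. f(i := z) \<in> {f. \<not> (\<exists>j\<in>insert i F. f j = u)}} = (if z = u then {} else {f. \<not> (\<exists>j\<in>F. f j = u)})"
        using insert.hyps by auto
      then show ?thesis by (simp add: a_def)
    qed
    then show ?thesis
      by (simp add: prob_Pi_pmf_insert[OF insert.hyps] compl)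
  qed
  have "measure_pmf.prob (Pi_pmf (insert i F) d q) {f. \<forall>v\<in>S. \<exists>j\<in>insert i F. f j = v}
      = measure_pmf.expectation (q i) h"
  proof -
    have "{f. f(i := z) \<in> {f. \<forall>v\<in>S. \<exists>j\<in>insert i F. f j = v}} = {f. \<forall>v\<in>S - {z}. \<exists>j\<in>F. f j = v}" for z
      using insert.hyps by auto
    then show ?thesis
      by (simp add: prob_Pi_pmf_insert[OF insert.hyps] h_def)
  qed
  also have "h = (\<lambda>z. indicator (- {u}) z * h z + indicator {u} z * h u)"
    by (auto split: split_indicator)
  then have "measure_pmf.expectation (q i) h
      = measure_pmf.expectation (q i) (\<lambda>z. indicator (- {u}) z * h z + indicator {u} z * h u)"
    by simp
  also have "\<dots> = T + r * h u"
    by (subst Bochner_Integration.integral_add[OF int(1,2)]) (simp add: T_def r_def measure_pmf_single)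
  finally have occ: "measure_pmf.prob (Pi_pmf (insert i F) d q) {f. \<forall>v\<in>S. \<exists>j\<in>insert i F. f j = v} = T + r * h u" .
  have "h u \<le> h z" for z
    using insert.prems unfolding h_def by (intro measure_pmf.finite_measure_mono) auto
  then have "measure_pmf.expectation (q i) (\<lambda>z. indicator (- {u}) z * h u) \<le> T"
    unfolding T_def by (intro integral_mono int mult_left_mono) auto
  then have T: "(1 - r) * h u \<le> T"
    by (simp add: compl)
  have "T * a = measure_pmf.expectation (q i) (\<lambda>z. indicator (- {u}) z * (h z * a))"
    unfolding T_def by (simp flip: mult.assoc)
  \<comment> \<open>The induction hypothesis is used at \<open>S - {z}\<close>, a set that varies
    with the value of coordinate \<open>i\<close>.\<close>
  also have "\<dots> \<le> measure_pmf.expectation (q i) (\<lambda>z. indicator (- {u}) z *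
      ?P {f. (\<forall>v\<in>S - {z}. \<exists>j\<in>F. f j = v) \<and> \<not> (\<exists>j\<in>F. f j = u)})"
    using insert.IH insert.prems unfolding h_def a_def
    by (intro integral_mono int[unfolded h_def a_def] mult_left_mono)
      (auto intro!: measure_pmf.integrable_const_bound[where B = 1] split: split_indicator)
  also have "\<dots> = measure_pmf.prob (Pi_pmf (insert i F) d q)
      {f. (\<forall>v\<in>S. \<exists>j\<in>insert i F. f j = v) \<and> \<not> (\<exists>j\<in>insert i F. f j = u)}"
  proof -
    have "{f. f(i := z) \<in> {f. (\<forall>v\<in>S. \<exists>j\<in>insert i F. f j = v) \<and> \<not> (\<exists>j\<in>insert i F. f j = u)}}
      = (if z = u then {} else {f. (\<forall>v\<in>S - {z}. \<exists>j\<in>F. f j = v) \<and> \<not> (\<exists>j\<in>F. f j = u)})" for z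
      using insert.hyps by auto
    then have "?P {f. f(i := z) \<in> {f. (\<forall>v\<in>S. \<exists>j\<in>insert i F. f j = v) \<and> \<not> (\<exists>j\<in>insert i F. f j = u)}}
      = indicator (- {u}) z * ?P {f. (\<forall>v\<in>S - {z}. \<exists>j\<in>F. f j = v) \<and> \<not> (\<exists>j\<in>F. f j = u)}" for z
      by (auto split: split_indicator)
    then show ?thesis
      by (simp add: prob_Pi_pmf_insert[OF insert.hyps])
  qed
  finally have "T * a \<le> \<dots>" .
  \<comment> \<open>The mean of \<open>h\<close> is at most its mean conditional on
    \<open>z \<noteq> u\<close>, written without dividing by \<open>1 - r\<close>.\<close>
  moreover have "(T + r * h u) * (1 - r) \<le> T"
    using mult_left_mono[OF T r(1)] by (simp add: algebra_simps)
  then have "(T + r * h u) * ((1 - r) * a) \<le> T * a"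
    unfolding mult.assoc[symmetric] by (rule mult_right_mono) (simp add: a_def)
  ultimately show ?case
    unfolding avoid occ by linarith
qed auto

text \<open>Values are added to \<open>S\<close> one at a time. Avoiding \<open>u\<close> is
  positively correlated with occupying \<open>S\<close>, so passing to the complement, occupying
  \<open>u\<close> is negatively correlated with it.\<close>

lemma prob_all_occupied_le:
  assumes "finite F" "finite S"
  shows "measure_pmf.prob (Pi_pmf F d q) {f. \<forall>v\<in>S. \<exists>j\<in>F. f j = v}
    \<le> (\<Prod>v\<in>S. measure_pmf.prob (Pi_pmf F d q) {f. \<exists>j\<in>F. f j = v})"
  using assms(2)
proof (induction S rule: finite_induct)
  case (insert u S)
  let ?P = "measure_pmf.prob (Pi_pmf F d q)"
  let ?A = "{f. \<forall>v\<in>S. \<exists>j\<in>F. f j = v}" and ?B = "{f. \<exists>j\<in>F. f j = u}"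
  have "?P (?A \<inter> ?B) = ?P ?A - ?P (?A - ?B)"
    by (subst measure_pmf.finite_measure_Diff') auto
  moreover have "?P ?A * ?P (- ?B) \<le> ?P (?A - ?B)"
    using prob_occupied_avoid_ge[OF assms(1) insert.hyps(2), of d q]
    by (simp add: set_diff_eq Collect_neg_eq[symmetric])
  moreover have "?P (- ?B) = 1 - ?P ?B"
    using measure_pmf.prob_compl[of ?B "Pi_pmf F d q"] by (simp add: Compl_eq_Diff_UNIV)
  ultimately have "?P (?A \<inter> ?B) \<le> ?P ?B * ?P ?A"
    by (simp add: algebra_simps)
  also have "\<dots> \<le> ?P ?B * (\<Prod>v\<in>S. ?P {f. \<exists>j\<in>F. f j = v})"
    by (intro mult_left_mono insert.IH) auto
  also have "?A \<inter> ?B = {f. \<forall>v\<in>insert u S. \<exists>j\<in>F. f j = v}" by auto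
  finally show ?case using insert.hyps by simp
qed auto

lemma prob_all_avoided_le:
  assumes "finite F" "finite S"
  shows "measure_pmf.prob (Pi_pmf F d q) {f. \<forall>v\<in>S. \<not> (\<exists>j\<in>F. f j = v)}
    \<le> (\<Prod>v\<in>S. measure_pmf.prob (Pi_pmf F d q) {f. \<not> (\<exists>j\<in>F. f j = v)})"
  using assms(2)
proof (induction S rule: finite_induct)
  case (insert u S)
  have "measure_pmf.prob (Pi_pmf F d q) {f. \<forall>v\<in>insert u S. \<not> (\<exists>j\<in>F. f j = v)}
    \<le> measure_pmf.prob (Pi_pmf F d q) {f. \<not> (\<exists>j\<in>F. f j = u)}
      * measure_pmf.prob (Pi_pmf F d q) {f. \<forall>v\<in>S. \<not> (\<exists>j\<in>F. f j = v)}"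
    by (rule prob_avoid_insert_le[OF assms(1) insert.hyps(2)])
  also have "\<dots> \<le> measure_pmf.prob (Pi_pmf F d q) {f. \<not> (\<exists>j\<in>F. f j = u)}
      * (\<Prod>v\<in>S. measure_pmf.prob (Pi_pmf F d q) {f. \<not> (\<exists>j\<in>F. f j = v)})"
    by (intro mult_left_mono insert.IH) auto
  finally show ?case using insert.hyps by simp
qed auto

section \<open>Moment generating function of the number of occupied values\<close>

lemma power_card_filter:
  fixes a :: "'a :: comm_monoid_mult"
  assumes "finite U"
  shows "a ^ card {u\<in>U. Q u} = (\<Prod>u\<in>U. if Q u then a else 1)"
  using assms by (simp add: prod.If_cases Int_def)

text \<open>The power is a product over \<open>u\<close> of affine functions of an indicator.
  Nonnegative coefficients call for the indicator of occupation if \<open>a \<ge> 1\<close> and of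
  avoidance if \<open>a < 1\<close>, hence the two forms of negative dependence. Then
  \<open>1 + x \<le> exp x\<close> is applied to each factor.\<close>

lemma occupancy_mgf_le:
  fixes a :: real
  assumes F: "finite F" and U: "finite U" and a: "a > 0"
  shows "measure_pmf.expectation (Pi_pmf F d q) (\<lambda>f. a ^ card {u\<in>U. \<exists>j\<in>F. f j = u})
    \<le> exp ((a - 1) * (\<Sum>u\<in>U. measure_pmf.prob (Pi_pmf F d q) {f. \<exists>j\<in>F. f j = u}))"
proof -
  let ?P = "measure_pmf.prob (Pi_pmf F d q)"
  let ?b = "\<lambda>u. ?P {f. \<exists>j\<in>F. f j = u}"
  have fin: "finite S" if "S \<subseteq> U" for S using U that finite_subset by auto
  have "measure_pmf.expectation (Pi_pmf F d q) (\<lambda>f. a ^ card {u\<in>U. \<exists>j\<in>F. f j = u})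
      \<le> (\<Prod>u\<in>U. 1 + (a - 1) * ?b u)"
  proof (cases "a \<ge> 1")
    case True
    have "a ^ card {u\<in>U. \<exists>j\<in>F. f j = u} = (\<Prod>u\<in>U. (a - 1) * of_bool (\<exists>j\<in>F. f j = u) + 1)" for f
      unfolding power_card_filter[OF U] by (intro prod.cong) auto
    then show ?thesis
      using expectation_prod_of_bool_le[OF U, where c = "a - 1" and d = 1 and M = "Pi_pmf F d q"
        and B = "\<lambda>u f. \<exists>j\<in>F. f j = u"] True prob_all_occupied_le[OF F fin, of _ d q]
      by (simp add: add.commute)
  next
    case False
    have "a ^ card {u\<in>U. \<exists>j\<in>F. f j = u} = (\<Prod>u\<in>U. (1 - a) * of_bool (\<not> (\<exists>j\<in>F. f j = u)) + a)" for f
      unfolding power_card_filter[OF U] by (intro prod.cong) auto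
    then have "measure_pmf.expectation (Pi_pmf F d q) (\<lambda>f. a ^ card {u\<in>U. \<exists>j\<in>F. f j = u})
      = measure_pmf.expectation (Pi_pmf F d q)
          (\<lambda>f. \<Prod>u\<in>U. (1 - a) * of_bool (\<not> (\<exists>j\<in>F. f j = u)) + a)"
      by simp
    also have "\<dots> \<le> (\<Prod>u\<in>U. (1 - a) * ?P {f. \<not> (\<exists>j\<in>F. f j = u)} + a)"
      using False a by (intro expectation_prod_of_bool_le[OF U] prob_all_avoided_le[OF F fin]) auto
    also have "?P {f. \<not> (\<exists>j\<in>F. f j = u)} = 1 - ?b u" for u
      using measure_pmf.prob_compl[of "{f. \<exists>j\<in>F. f j = u}" "Pi_pmf F d q"]
      by (simp add: Compl_eq_Diff_UNIV[symmetric] Collect_neg_eq[symmetric])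
    then have "(\<Prod>u\<in>U. (1 - a) * ?P {f. \<not> (\<exists>j\<in>F. f j = u)} + a) = (\<Prod>u\<in>U. 1 + (a - 1) * ?b u)"
      by (intro prod.cong refl) (simp only:, simp add: algebra_simps)
    finally show ?thesis .
  qed
  also have "\<dots> \<le> (\<Prod>u\<in>U. exp ((a - 1) * ?b u))"
  proof (intro prod_mono conjI)
    fix u
    \<comment> \<open>Monotonicity of the product requires nonnegative factors.\<close>
    have "(1 - a) * ?b u \<le> 1"
    proof (cases "a \<ge> 1")
      case True
      then have "(1 - a) * ?b u \<le> 0" by (intro mult_nonpos_nonneg) auto
      then show ?thesis by simp
    qed (use a in \<open>auto intro!: mult_le_one\<close>)
    then show "0 \<le> 1 + (a - 1) * ?b u" by (simp add: algebra_simps)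
  qed (rule exp_ge_add_one_self)
  also have "\<dots> = exp ((a - 1) * (\<Sum>u\<in>U. ?b u))"
    by (simp add: exp_sum[OF U] sum_distrib_left)
  finally show ?thesis .
qed

section \<open>Independence of the multiplicities under Poisson sampling\<close>

text \<open>The multinomial formula with all symbols outside \<open>F\<close> merged into one class,
  by induction on the sample size, conditioning on the first symbol.\<close>

lemma prob_counts_replicate_pmf:
  fixes p :: "'a pmf" and k :: "'a \<Rightarrow> nat"
  assumes F: "finite F"
  shows "measure_pmf.prob (replicate_pmf N p) {xs. \<forall>x\<in>F. count_list xs x = k x} =
    (if sum k F \<le> N
     then fact N * (\<Prod>x\<in>F. pmf p x ^ k x / fact (k x)) *
       (measure_pmf.prob p (- F) ^ (N - sum k F) / fact (N - sum k F))
     else 0)"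
proof (induction N arbitrary: k)
  case 0
  show ?case
  proof (cases "sum k F = 0")
    case True
    with F show ?thesis by simp
  next
    case False
    then obtain x where "x \<in> F" "k x \<noteq> 0" using F by auto
    then show ?thesis using F False by (auto simp: indicator_def)
  qed
next
  case (Suc N)
  let ?Q = "\<lambda>N k. measure_pmf.prob (replicate_pmf N p) {xs. \<forall>x\<in>F. count_list xs x = k x}"
  define r where "r = measure_pmf.prob p (- F)"
  define c where "c = (\<lambda>k N. if sum k F \<le> N then (\<Prod>x\<in>F. pmf p x ^ k x / fact (k x)) *
       (r ^ (N - sum k F) / fact (N - sum k F)) else 0)"
  have IH: "?Q N k = fact N * c k N" for k
    using Suc[of k] by (simp add: c_def r_def)
  \<comment> \<open>A first symbol \<open>z\<close> in \<open>F\<close> lowers the count still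
    required of \<open>z\<close> by one, which is impossible if that count is \<open>0\<close>. A
    first symbol outside \<open>F\<close> leaves the requirements unchanged.\<close>
  define g where "g = (\<lambda>z. if k z = 0 then 0 else ?Q N (k(z := k z - 1)))"
  have g01: "0 \<le> g z" "g z \<le> 1" for z by (auto simp: g_def)
  have cons: "measure_pmf.prob (replicate_pmf N p) {xs. \<forall>x\<in>F. count_list (z # xs) x = k x}
      = (\<Sum>x\<in>F. g x * indicator {x} z) + ?Q N k * indicator (- F) z" for z
  proof (cases "z \<in> F")
    case True
    have "{xs. \<forall>x\<in>F. count_list (z # xs) x = k x} =
        (if k z = 0 then {} else {xs. \<forall>x\<in>F. count_list xs x = (k(z := k z - 1)) x})"
      using True by (auto simp: split: if_splits)
    moreover have "(\<Sum>x\<in>F. g x * indicator {x} z) = g z"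
      using True F by (subst sum.remove[of _ z]) (auto intro!: sum.neutral simp: indicator_def)
    ultimately show ?thesis using True by (simp add: g_def)
  next
    case False
    then have "{xs. \<forall>x\<in>F. count_list (z # xs) x = k x} = {xs. \<forall>x\<in>F. count_list xs x = k x}"
      by auto
    moreover have "(\<Sum>x\<in>F. g x * indicator {x} z) = 0"
      using False by (intro sum.neutral) (auto simp: indicator_def)
    ultimately show ?thesis using False by simp
  qed
  have "?Q (Suc N) k = measure_pmf.expectation p
      (\<lambda>z. measure_pmf.prob (replicate_pmf N p) {xs. \<forall>x\<in>F. count_list (z # xs) x = k x})"
    by (simp add: measure_bind_pmf vimage_def flip: map_pmf_def del: count_list.simps)
  also have "\<dots> = (\<Sum>x\<in>F. g x * pmf p x) + ?Q N k * r"
  proof -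
    have ind: "integrable (measure_pmf p) (indicator A :: 'a \<Rightarrow> real)" for A
      by (intro measure_pmf.integrable_const_bound[where B = 1]) auto
    show ?thesis
      unfolding cons r_def by (simp add: ind measure_pmf_single)
  qed
  \<comment> \<open>Every summand is a multiple of \<open>fact N * w * s\<close>; the factors \<open>k x\<close> and
    \<open>Suc N - sum k F\<close> add up to \<open>Suc N\<close>.\<close>
  also have "\<dots> = fact (Suc N) * c k (Suc N)"
  proof -
    define w where "w = (\<Prod>x\<in>F. pmf p x ^ k x / fact (k x))"
    define s where "s = (if sum k F \<le> Suc N then r ^ (Suc N - sum k F) / fact (Suc N - sum k F) else 0)"
    have "g x * pmf p x = real (k x) * (fact N * (w * s))" if x: "x \<in> F" for x
    proof (cases "k x")
      case 0
      then show ?thesis by (simp add: g_def)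
    next
      case (Suc l)
      define k' where "k' = k(x := l)"
      have sums: "sum k F = Suc (sum k' F)"
        using F x Suc by (simp add: k'_def sum.remove[of F x])
      \<comment> \<open>Removing one occurrence of \<open>x\<close> splits off one factor of the
        power and one of the factorial.\<close>
      have "w = pmf p x / real (k x) * (\<Prod>x\<in>F. pmf p x ^ k' x / fact (k' x))"
        using F x Suc by (simp add: w_def k'_def prod.remove[of F x])
      then have "real (k x) * w = pmf p x * (\<Prod>x\<in>F. pmf p x ^ k' x / fact (k' x))"
        using Suc by simp
      moreover have "g x = fact N * c k' N"
        using Suc IH[of k'] by (simp add: g_def k'_def)
      ultimately show ?thesis
        by (simp add: c_def s_def sums)
    qed
    then have "(\<Sum>x\<in>F. g x * pmf p x) = real (sum k F) * (fact N * (w * s))"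
      by (simp add: sum_distrib_right)
    moreover have "?Q N k * r = real (Suc N - sum k F) * (fact N * (w * s))"
    proof (cases "sum k F \<le> N")
      case True
      then obtain m where m: "N = sum k F + m" using le_Suc_ex by blast
      then have "s = r * (r ^ m / fact m) / real (Suc m)"
        by (simp add: s_def Suc_diff_le)
      then have "real (Suc m) * s = r * (r ^ m / fact m)"
        by (simp del: of_nat_Suc)
      moreover have "Suc N - sum k F = Suc m" "c k N = w * (r ^ m / fact m)"
        using m by (simp_all add: c_def w_def)
      ultimately show ?thesis
        by (metis IH mult.assoc mult.commute)
    next
      case False
      then show ?thesis by (simp add: IH c_def)
    qed
    moreover have "c k (Suc N) = w * s"
      by (simp add: c_def w_def s_def)
    \<comment> \<open>Here \<open>s \<noteq> 0\<close> forces \<open>sum k F \<le> Suc N\<close>, so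
      that the truncated subtraction is exact.\<close>
    moreover have "real (sum k F) + real (Suc N - sum k F) = real (Suc N)" if "s \<noteq> 0"
      using that by (auto simp: s_def split: if_splits)
    ultimately show ?thesis
      by (cases "s = 0") (simp_all flip: distrib_right)
  qed
  finally show ?case by (simp add: c_def r_def)
qed

text \<open>Poisson splitting: averaging the multinomial formula over a Poisson size makes it
  factorize. Counts outside \<open>F\<close> are set to \<open>0\<close> to match the default value
  of \<open>Pi_pmf\<close>.\<close>

lemma counts_poissonized_sample:
  assumes F: "finite F" "F \<subseteq> set_pmf p" and n: "n > 0"
  shows "map_pmf (\<lambda>xs x. if x \<in> F then count_list xs x else 0) (poissonized_sample n p)
    = Pi_pmf F 0 (\<lambda>x. poisson_pmf (real n * pmf p x))"
proof (rule pmf_eqI)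
  fix k :: "'a \<Rightarrow> nat"
  let ?Q = "\<lambda>N. measure_pmf.prob (replicate_pmf N p) {xs. \<forall>x\<in>F. count_list xs x = k x}"
  show "pmf (map_pmf (\<lambda>xs x. if x \<in> F then count_list xs x else 0) (poissonized_sample n p)) k
    = pmf (Pi_pmf F 0 (\<lambda>x. poisson_pmf (real n * pmf p x))) k"
  proof (cases "\<forall>x. x \<notin> F \<longrightarrow> k x = 0")
    case False
    then have "(\<lambda>xs x. if x \<in> F then count_list xs x else 0) -` {k} = {}" by auto
    moreover have "pmf (Pi_pmf F 0 (\<lambda>x. poisson_pmf (real n * pmf p x))) k = 0"
      using False by (intro pmf_Pi_outside F) auto
    ultimately show ?thesis
      by (simp add: pmf_map)
  next
    case True
    define K where "K = sum k F"
    define r where "r = measure_pmf.prob p (- F)"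
    define w where "w = (\<Prod>x\<in>F. pmf p x ^ k x / fact (k x))"
    from True have "(\<lambda>xs x. if x \<in> F then count_list xs x else 0) -` {k} = {xs. \<forall>x\<in>F. count_list xs x = k x}"
      by (auto simp: fun_eq_iff)
    then have "pmf (map_pmf (\<lambda>xs x. if x \<in> F then count_list xs x else 0) (poissonized_sample n p)) k
      = measure_pmf.expectation (poisson_pmf (real n)) ?Q"
      by (simp add: pmf_map poissonized_sample_def measure_bind_pmf)
    also have "\<dots> = (\<Sum>N. pmf (poisson_pmf (real n)) N * ?Q N)"
      by (rule expectation_nat_pmf_bounded[where B = 1]) simp
    also have "\<dots> = w * real n ^ K * exp (real n * r - real n)"
    proof (rule sums_unique[symmetric])
      \<comment> \<open>Sizes below \<open>K\<close> cannot realize the counts. After a shift by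
        \<open>K\<close>, summing over the number \<open>j\<close> of symbols outside
        \<open>F\<close> gives the exponential series at \<open>n * r\<close>.\<close>
      let ?f = "\<lambda>N. pmf (poisson_pmf (real n)) N * ?Q N"
      have "(\<lambda>j. w * real n ^ K * exp (- real n) * ((real n * r) ^ j /\<^sub>R fact j)) sums
          (w * real n ^ K * exp (- real n) * exp (real n * r))"
        by (intro sums_mult exp_converges)
      moreover have "?f (j + K) = w * real n ^ K * exp (- real n) * ((real n * r) ^ j /\<^sub>R fact j)" for j
        using n by (simp add: prob_counts_replicate_pmf[OF F(1)] w_def K_def r_def power_add
            power_mult_distrib field_simps)
      ultimately have "(\<lambda>j. ?f (j + K)) sums (w * real n ^ K * exp (- real n) * exp (real n * r))"
        by simp
      moreover have "(\<Sum>i<K. ?f i) = 0"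
        by (intro sum.neutral) (simp add: prob_counts_replicate_pmf[OF F(1)] K_def)
      ultimately show "?f sums (w * real n ^ K * exp (real n * r - real n))"
        using sums_iff_shift[of ?f K "w * real n ^ K * exp (- real n) * exp (real n * r)"]
        by (simp add: exp_diff exp_minus field_simps)
    qed
    also have "\<dots> = (\<Prod>x\<in>F. (real n * pmf p x) ^ k x / fact (k x) * exp (- (real n * pmf p x)))"
    proof -
      have "r = 1 - (\<Sum>x\<in>F. pmf p x)"
        using measure_pmf.prob_compl[of F p] F
        by (simp add: r_def Compl_eq_Diff_UNIV measure_measure_pmf_finite)
      then have "real n * r - real n = (\<Sum>x\<in>F. - (real n * pmf p x))"
        by (simp add: right_diff_distrib sum_negf flip: sum_distrib_left)
      then have "exp (real n * r - real n) = (\<Prod>x\<in>F. exp (- (real n * pmf p x)))"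
        by (simp add: exp_sum F)
      then show ?thesis
        by (simp add: w_def K_def power_sum power_mult_distrib mult_ac flip: prod.distrib)
    qed
    also have "\<dots> = pmf (Pi_pmf F 0 (\<lambda>x. poisson_pmf (real n * pmf p x))) k"
    proof -
      have "real n * pmf p x > 0" if "x \<in> F" for x
        using that F n by (auto intro!: mult_pos_pos pmf_positive)
      then show ?thesis
        using True by (simp add: pmf_Pi F cong: prod.cong)
    qed
    finally show ?thesis .
  qed
qed

section \<open>Moment generating function under Poisson sampling\<close>

text \<open>With symbols as coordinates and independent multiplicities as their values, "some symbol
  has multiplicity \<open>u\<close>" becomes "\<open>u\<close> is occupied".\<close>

lemma poissonized_mgf_le_finite:
  fixes a :: real
  assumes F: "finite F" "F \<subseteq> set_pmf p" and n: "n > 0" and a: "a > 0" and U: "finite U" "0 \<notin> U"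
  shows "measure_pmf.expectation (poissonized_sample n p) (\<lambda>xs. a ^ card {u\<in>U. \<exists>x\<in>F. count_list xs x = u})
    \<le> exp ((a - 1) * (\<Sum>u\<in>U. measure_pmf.prob (poissonized_sample n p) {xs. \<exists>x\<in>F. count_list xs x = u}))"
proof -
  let ?cnt = "\<lambda>xs x. if x \<in> F then count_list xs x else 0"
  have "card {u\<in>U. \<exists>x\<in>F. ?cnt xs x = u} = card {u\<in>U. \<exists>x\<in>F. count_list xs x = u}"
    and "{xs. \<exists>x\<in>F. ?cnt xs x = u} = {xs. \<exists>x\<in>F. count_list xs x = u}" for xs :: "'a list" and u
    by (auto intro!: arg_cong[where f = card])
  then show ?thesis
    using occupancy_mgf_le[OF F(1) U(1) a, of 0 "\<lambda>x. poisson_pmf (real n * pmf p x)"]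
    unfolding counts_poissonized_sample[OF F n, symmetric]
    by (simp add: vimage_def)
qed

text \<open>The support may be infinite, so it is exhausted by finite initial segments
  \<open>G m\<close> of an enumeration. Both sides converge, the left one by dominated
  convergence.\<close>

lemma poissonized_mgf_le:
  fixes a :: real
  assumes n: "n > 0" and a: "a > 0" and U: "finite U" "0 \<notin> U"
  shows "measure_pmf.expectation (poissonized_sample n p)
      (\<lambda>xs. a ^ card {u\<in>U. \<exists>x\<in>set_pmf p. count_list xs x = u})
    \<le> exp ((a - 1) * (\<Sum>u\<in>U. measure_pmf.prob (poissonized_sample n p)
        {xs. \<exists>x\<in>set_pmf p. count_list xs x = u}))"
proof -
  define G where "G m = {x \<in> set_pmf p. to_nat_on (set_pmf p) x \<le> m}" for m
  let ?M = "poissonized_sample n p"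
  let ?hit = "\<lambda>G u. {xs. \<exists>x\<in>G. count_list xs x = u}"
  let ?D = "\<lambda>G xs. card {u\<in>U. \<exists>x\<in>G. count_list xs x = u}"
  have G: "finite (G m)" "G m \<subseteq> set_pmf p" for m
  proof -
    have "inj_on (to_nat_on (set_pmf p)) (G m)"
      by (rule inj_on_subset[OF inj_on_to_nat_on]) (auto simp: G_def)
    moreover have "to_nat_on (set_pmf p) ` G m \<subseteq> {..m}" by (auto simp: G_def)
    ultimately show "finite (G m)" by (rule inj_on_finite) simp
  qed (auto simp: G_def)
  have mono: "G l \<subseteq> G m" if "l \<le> m" for l m using that by (auto simp: G_def)
  have UG: "(\<Union>m. G m) = set_pmf p" by (auto simp: G_def)
  have prob_lim: "(\<lambda>m. measure_pmf.prob ?M (?hit (G m) u)) \<longlonglongrightarrow> measure_pmf.prob ?M (?hit (set_pmf p) u)" for u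
  proof -
    have "incseq (\<lambda>m. ?hit (G m) u)"
      unfolding incseq_def using mono by blast
    then have "(\<lambda>m. measure_pmf.prob ?M (?hit (G m) u)) \<longlonglongrightarrow> measure_pmf.prob ?M (\<Union>m. ?hit (G m) u)"
      by (intro measure_pmf.finite_Lim_measure_incseq) auto
    also have "(\<Union>m. ?hit (G m) u) = ?hit (set_pmf p) u" unfolding UG[symmetric] by auto
    finally show ?thesis .
  qed
  have ev: "\<forall>\<^sub>F m in sequentially. ?D (G m) xs = ?D (set_pmf p) xs" for xs :: "'a list"
  proof -
    have "\<forall>\<^sub>F m in sequentially. (\<exists>x\<in>G m. count_list xs x = u) \<longleftrightarrow> (\<exists>x\<in>set_pmf p. count_list xs x = u)" for u
    proof (cases "\<exists>x\<in>set_pmf p. count_list xs x = u")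
      case True
      then obtain x m0 where x: "x \<in> G m0" "count_list xs x = u" unfolding UG[symmetric] by blast
      show ?thesis
        using eventually_ge_at_top[of m0]
        by eventually_elim (use x mono True in blast)
    next
      case False
      then show ?thesis
        using G(2) by (intro always_eventually) blast
    qed
    \<comment> \<open>Since \<open>U\<close> is finite, one threshold for \<open>m\<close> serves
      all \<open>u\<close>.\<close>
    then have "\<forall>\<^sub>F m in sequentially. \<forall>u\<in>U. (\<exists>x\<in>G m. count_list xs x = u) \<longleftrightarrow> (\<exists>x\<in>set_pmf p. count_list xs x = u)"
      by (intro eventually_ball_finite U ballI)
    then show ?thesis
      by eventually_elim (auto intro!: arg_cong[where f = card])
  qed
  \<comment> \<open>The maximum with \<open>1\<close> makes the bound valid on both sides of
    \<open>a = 1\<close>.\<close>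
  have bound: "\<bar>a ^ ?D H xs\<bar> \<le> max 1 a ^ card U" for H and xs :: "'a list"
  proof -
    have "a ^ ?D H xs \<le> max 1 a ^ ?D H xs"
      using a by (intro power_mono) auto
    also have "\<dots> \<le> max 1 a ^ card U"
      by (intro power_increasing card_mono U) auto
    finally show ?thesis using a by simp
  qed
  have "(\<lambda>m. measure_pmf.expectation ?M (\<lambda>xs. a ^ ?D (G m) xs))
      \<longlonglongrightarrow> measure_pmf.expectation ?M (\<lambda>xs. a ^ ?D (set_pmf p) xs)"
  proof (rule integral_dominated_convergence[where w = "\<lambda>_. max 1 a ^ card U"])
    show "AE xs in ?M. (\<lambda>m. a ^ ?D (G m) xs) \<longlonglongrightarrow> a ^ ?D (set_pmf p) xs"
    proof (intro AE_pmfI tendsto_eventually)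
      fix xs
      show "\<forall>\<^sub>F m in sequentially. a ^ ?D (G m) xs = a ^ ?D (set_pmf p) xs"
        by (rule eventually_mono[OF ev[of xs]]) simp
    qed
  qed (use bound in auto)
  moreover have "(\<lambda>m. exp ((a - 1) * (\<Sum>u\<in>U. measure_pmf.prob ?M (?hit (G m) u))))
      \<longlonglongrightarrow> exp ((a - 1) * (\<Sum>u\<in>U. measure_pmf.prob ?M (?hit (set_pmf p) u)))"
    by (intro tendsto_intros prob_lim)
  ultimately show ?thesis
    by (rule LIMSEQ_le) (use poissonized_mgf_le_finite[OF G n a U] in auto)
qed

section \<open>Transfer to samples of fixed size, and the tail bounds\<close>

text \<open>Linearity of expectation. Almost surely only symbols of the support occur, so for
  \<open>u \<ge> 1\<close> the alphabet \<open>X\<close> and the support define the same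
  event.\<close>

lemma expected_profile_dim_conv_prob:
  assumes "set_pmf p \<subseteq> X"
  shows "expected_profile_dim X n p =
    (\<Sum>u=1..n. measure_pmf.prob (poissonized_sample n p) {xs. \<exists>x\<in>set_pmf p. count_list xs x = u})"
proof -
  let ?M = "poissonized_sample n p"
  have set: "set xs \<subseteq> set_pmf p" if "xs \<in> set_pmf ?M" for xs
    using that by (auto simp: poissonized_sample_def set_replicate_pmf)
  have "expected_profile_dim X n p = measure_pmf.expectation ?M
      (\<lambda>xs. \<Sum>u=1..n. indicator {xs. \<exists>x\<in>set_pmf p. count_list xs x = u} xs)"
    unfolding expected_profile_dim_def
  proof (intro integral_cong_AE AE_pmfI)
    fix xs assume "xs \<in> set_pmf ?M"
    then have "x \<in> set_pmf p" if "count_list xs x \<ge> 1" for x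
      using that set[of xs] count_notin[of x xs] by force
    then show "(\<Sum>u=1..n. of_bool (\<exists>x\<in>X. count_list xs x = u)) =
        (\<Sum>u=1..n. indicator {xs. \<exists>x\<in>set_pmf p. count_list xs x = u} xs :: real)"
      using assms by (intro sum.cong refl) (auto simp: indicator_def)
  qed auto
  also have "\<dots> = (\<Sum>u=1..n. measure_pmf.prob ?M {xs. \<exists>x\<in>set_pmf p. count_list xs x = u})"
    by (subst Bochner_Integration.integral_sum)
      (auto intro!: measure_pmf.integrable_const_bound[where B = 1] split: split_indicator)
  finally show ?thesis .
qed

text \<open>The Poisson sample is a mixture over its size, in which the size \<open>n\<close> has
  weight at least \<open>1 / (3 * sqrt n)\<close>.\<close>

lemma prob_replicate_le_poissonized:
  assumes "n > 0"
  shows "measure_pmf.prob (replicate_pmf n p) A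
    \<le> 3 * sqrt (real n) * measure_pmf.prob (poissonized_sample n p) A"
proof -
  let ?f = "\<lambda>N. measure_pmf.prob (replicate_pmf N p) A"
  let ?q = "poisson_pmf (real n)"
  have "?f n * pmf ?q n = measure_pmf.expectation ?q (\<lambda>N. ?f n * indicator {n} N)"
    by (simp add: measure_pmf_single)
  also have "\<dots> \<le> measure_pmf.expectation ?q ?f"
    by (intro integral_mono integrable_prob_pmf measure_pmf.integrable_const_bound[where B = 1])
      (auto split: split_indicator)
  also have "\<dots> = measure_pmf.prob (poissonized_sample n p) A"
    by (simp add: poissonized_sample_def measure_bind_pmf)
  finally have "?f n * pmf ?q n \<le> measure_pmf.prob (poissonized_sample n p) A" .
  moreover have "?f n * (1 / (3 * sqrt (real n))) \<le> ?f n * pmf ?q n"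
    by (intro mult_left_mono pmf_poisson_mean_ge assms) auto
  ultimately have "?f n * (1 / (3 * sqrt (real n))) \<le> measure_pmf.prob (poissonized_sample n p) A"
    by linarith
  then show ?thesis using assms by (simp add: field_simps)
qed

text \<open>
  Multiplying by \<open>ln a\<close> in the hypothesis on \<open>A\<close> covers both tails: the sign of \<open>ln a\<close> decides
  whether \<open>A\<close> bounds the profile dimension from below or from above.
\<close>

lemma profile_dim_mgf_tail:
  fixes a t :: real
  assumes p: "set_pmf p \<subseteq> X" and n: "n > 0" and a: "a > 0"
    and A: "\<And>xs. xs \<in> A \<Longrightarrow> t * ln a \<le> real (profile_dim xs) * ln a"
  shows "measure_pmf.prob (replicate_pmf n p) A
    \<le> 3 * sqrt (real n) * exp ((a - 1) * expected_profile_dim X n p - t * ln a)"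
proof -
  let ?D = "\<lambda>xs. card {u\<in>{1..n}. \<exists>x\<in>set_pmf p. count_list xs x = u}"
  let ?B = "{xs. t * ln a \<le> real (?D xs) * ln a}"
  have exp_D: "a ^ ?D xs = exp (real (?D xs) * ln a)" for xs :: "'a list"
    using a by (simp add: exp_of_nat_mult)
  \<comment> \<open>At size \<open>n\<close> no multiplicity exceeds \<open>n\<close>, so cutting
    off at \<open>n\<close> loses nothing and \<open>?D\<close> is the profile dimension.\<close>
  have "measure_pmf.prob (replicate_pmf n p) A \<le> measure_pmf.prob (replicate_pmf n p) ?B"
  proof (rule measure_pmf.finite_measure_mono_AE)
    show "AE xs in replicate_pmf n p. xs \<in> A \<longrightarrow> xs \<in> ?B"
    proof (intro AE_pmfI impI)
      fix xs assume xs: "xs \<in> set_pmf (replicate_pmf n p)" "xs \<in> A"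
      then have "profile_dim xs = ?D xs"
        using profile_dim_altdef[of xs "set_pmf p" n]
        by (auto simp: set_replicate_pmf sum.If_cases of_bool_def Int_def)
      then show "xs \<in> ?B" using A[OF xs(2)] by simp
    qed
  qed auto
  also have "\<dots> \<le> 3 * sqrt (real n) * measure_pmf.prob (poissonized_sample n p) ?B"
    by (rule prob_replicate_le_poissonized[OF n])
  also have "measure_pmf.prob (poissonized_sample n p) ?B
      \<le> exp ((a - 1) * expected_profile_dim X n p) / exp (t * ln a)"
  proof -
    have "integrable (measure_pmf (poissonized_sample n p)) (\<lambda>xs. a ^ ?D xs)"
    proof (rule measure_pmf.integrable_const_bound[where B = "max 1 a ^ n"])
      show "AE xs in poissonized_sample n p. norm (a ^ ?D xs) \<le> max 1 a ^ n"
      proof (rule AE_pmfI)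
        fix xs :: "'a list"
        have "a ^ ?D xs \<le> max 1 a ^ ?D xs"
          using a by (intro power_mono) auto
        also have "\<dots> \<le> max 1 a ^ n"
          using card_mono[of "{1..n}" "{u\<in>{1..n}. \<exists>x\<in>set_pmf p. count_list xs x = u}"]
          by (intro power_increasing) (auto simp del: atLeastAtMost_iff)
        finally show "norm (a ^ ?D xs) \<le> max 1 a ^ n" using a by simp
      qed
    qed auto
    \<comment> \<open>Markov's inequality for the variable \<open>a ^ ?D xs\<close>.\<close>
    then have "measure_pmf.prob (poissonized_sample n p) {xs \<in> space (poissonized_sample n p). exp (t * ln a) \<le> a ^ ?D xs}
        \<le> measure_pmf.expectation (poissonized_sample n p) (\<lambda>xs. a ^ ?D xs) / exp (t * ln a)"
      using a by (intro integral_Markov_inequality_measure[where A = "{}"]) auto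
    also have "\<dots> \<le> exp ((a - 1) * expected_profile_dim X n p) / exp (t * ln a)"
      unfolding expected_profile_dim_conv_prob[OF p]
      by (intro divide_right_mono poissonized_mgf_le n a) auto
    finally show ?thesis by (simp only: exp_D exp_le_cancel_iff space_measure_pmf UNIV_I simp_thms)
  qed
  finally show ?thesis by (simp add: exp_diff mult_left_mono)
qed

theorem theorem6:
  fixes X :: "'a set" and p :: "'a pmf" and n :: nat
  assumes "countable X" and "set_pmf p \<subseteq> X" and "n > 0"
  shows "(\<forall>\<gamma>::real. \<gamma> > 0 \<longrightarrow>
            measure_pmf.prob (replicate_pmf n p)
              {xs. real (profile_dim xs) / (1 + \<gamma>) \<ge> expected_profile_dim X n p}
            \<le> 3 * sqrt (real n) * exp (- (min (\<gamma>\<^sup>2) \<gamma> * expected_profile_dim X n p / 3)))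
       \<and> (\<forall>\<gamma>::real. 0 < \<gamma> \<and> \<gamma> < 1 \<longrightarrow>
            measure_pmf.prob (replicate_pmf n p)
              {xs. real (profile_dim xs) / (1 - \<gamma>) \<le> expected_profile_dim X n p}
            \<le> 3 * sqrt (real n) * exp (- (\<gamma>\<^sup>2 * expected_profile_dim X n p / 2)))"
proof -
  let ?E = "expected_profile_dim X n p"
  have E: "?E \<ge> 0"
    unfolding expected_profile_dim_conv_prob[OF assms(2)] by (intro sum_nonneg) auto
  show ?thesis
  proof (intro conjI allI impI)
    fix g :: real assume g: "g > 0"
    \<comment> \<open>Base \<open>a = 1 + g\<close> and threshold
      \<open>t = (1 + g) * ?E\<close>.\<close>
    have "measure_pmf.prob (replicate_pmf n p) {xs. real (profile_dim xs) / (1 + g) \<ge> ?E}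
        \<le> 3 * sqrt (real n) * exp (((1 + g) - 1) * ?E - ((1 + g) * ?E) * ln (1 + g))"
      using g by (intro profile_dim_mgf_tail assms mult_right_mono) (auto simp: field_simps)
    also have "((1 + g) - 1) * ?E - ((1 + g) * ?E) * ln (1 + g) \<le> - (min (g\<^sup>2) g * ?E / 3)"
      using mult_right_mono[OF chernoff_exponent_upper[OF g] E] by (simp add: algebra_simps)
    finally show "measure_pmf.prob (replicate_pmf n p) {xs. real (profile_dim xs) / (1 + g) \<ge> ?E}
        \<le> 3 * sqrt (real n) * exp (- (min (g\<^sup>2) g * ?E / 3))"
      by (simp add: mult_left_mono)
  next
    fix g :: real assume g: "0 < g \<and> g < 1"
    \<comment> \<open>Base \<open>a = 1 - g\<close> and threshold \<open>t = (1 - g) * ?E\<close>;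
      now \<open>ln a\<close> is negative and reverses the inequality.\<close>
    have "measure_pmf.prob (replicate_pmf n p) {xs. real (profile_dim xs) / (1 - g) \<le> ?E}
        \<le> 3 * sqrt (real n) * exp (((1 - g) - 1) * ?E - ((1 - g) * ?E) * ln (1 - g))"
      using g by (intro profile_dim_mgf_tail assms mult_right_mono_neg) (auto simp: field_simps)
    also have "((1 - g) - 1) * ?E - ((1 - g) * ?E) * ln (1 - g) \<le> - (g\<^sup>2 * ?E / 2)"
      using mult_right_mono[OF chernoff_exponent_lower E, of g] g by (simp add: algebra_simps)
    finally show "measure_pmf.prob (replicate_pmf n p) {xs. real (profile_dim xs) / (1 - g) \<le> ?E}
        \<le> 3 * sqrt (real n) * exp (- (g\<^sup>2 * ?E / 2))"
      by (simp add: mult_left_mono)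
  qed
qed

end
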